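(* Let $\theta^\star\in\mathbb{R}^p$ be a global minimum of $\mathcal{L}$ (so $\mathcal{L}(\theta^\star)=0$) that is linearly stable for stochastic SAM with learning rate $\eta>0$, perturbation radius $\rho\ge 0$ and batch size $B\ge 1$. Suppose there exists $\gamma>0$ such that $$\operatorname{Tr}\big(\Sigma(\theta)G(\theta)\big)\;\ge\;2\gamma\,\mathcal{L}(\theta)\,\|G(\theta)\|_F^2\qquad\text{for all }\theta\in\mathbb{R}^p .$$ Then $$\|H(\theta^\star)\|_F^2\left(1+\frac{\rho^2\gamma}{B}\|H(\theta^\star)\|_F^2\right)\le\frac{B}{\eta^2\gamma}.$$
   Context: **Model and loss.** Training data $(x_i,y_i)_{i=1}^n$ with $x_i\in\mathbb{R}^d$, $y_i\in\mathbb{R}$; a model $f(x;\theta)\in\mathbb{R}$ with parameters $\theta\in\mathbb{R}^p$, where each $\theta\mapsto f(x_i;\theta)$ is twice differentiable. $\ell_i(\theta)=\frac12|f(x_i;\theta)-y_i|^2$ and $\mathcal{L}(\theta)=\frac1n\sum_{i=1}^n\ell_i(\theta)$. The over-parameterized case is assumed: $\min_\theta\mathcal{L}(\theta)=0$. **Matrices.** $G(\theta)=\frac1n\sum_{i=1}^n\nabla f(x_i;\theta)\nabla f(x_i;\theta)^\top$ (Fisher matrix); $H(\theta)=G(\theta)+\frac1n\sum_{i=1}^n(f(x_i;\theta)-y_i)\nabla^2f(x_i;\theta)$ (the Hessian of $\mathcal{L}$). $\Sigma(\theta)=\frac1n\sum_{i=1}^n(\nabla\ell_i(\theta)-\nabla\mathcal{L}(\theta))(\nabla\ell_i(\theta)-\nabla\mathcal{L}(\theta))^\top$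 (gradient noise covariance). $\|\cdot\|_F$ is the Frobenius norm. **Stochastic SAM.** For a loss that is an average of per-sample losses $\ell_1,\dots,\ell_n$ and a batch $\xi=(\xi_1,\dots,\xi_B)$ of indices in $\{1,\dots,n\}$, put $\mathcal{L}_\xi(\theta)=\frac1B\sum_{j=1}^B\ell_{\xi_j}(\theta)$. Stochastic SAM is the iteration $$\theta^{t+1}=\theta^t-\eta\nabla\mathcal{L}_{\xi_t^1}\big(\theta^t+\rho\nabla\mathcal{L}_{\xi_t^2}(\theta^t)\big),\qquad t=0,1,2,\dots,$$ where all batches $\xi_t^1,\xi_t^2$ ($t\ge0$) are mutually independent and each consists of $B$ indices drawn independently and uniformly from $\{1,\dots,n\}$. Expectations $\mathbb{E}$ are over these random batches. **Linear stability.** The linearized model at $\theta^\star$ is $f_{\rm lin}(x;\theta)=f(x;\theta^\star)+\langle\nabla f(x;\theta^\star),\theta-\theta^\star\rangle$, with linearized loss $\mathcal{L}_{\rm lin}(\theta)=\frac{1}{2n}\sum_{i=1}^n(f_{\rm lin}(x_i;\theta)-y_i)^2$. The global minimum $\theta^\star$ is called linearly stable for SAM if there exists $C>0$ such that, when stochastic SAM is run on the linearized loss $\mathcal{L}_{\rm lin}$ (with per-sample losses $\frac12(f_{\rm lin}(x_i;\theta)-y_i)^2$) from any initial point $\theta^0$ in a neighbourhood of $\theta^\star$, one has $\mathbb{E}[\mathcal{L}_{\rm lin}(\theta^t)]\le C\,\mathbb{E}[\mathcal{L}_{\rm lin}(\theta^0)]$ for all $t\ge0$. *)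

theory Defs
  imports "HOL-Probability.Probability"
begin

definition grad :: "(real^'p \<Rightarrow> real) \<Rightarrow> real^'p \<Rightarrow> real^'p" where
  "grad g \<theta> = (\<chi> j. frechet_derivative g (at \<theta>) (axis j 1))"

definition hess :: "(real^'p \<Rightarrow> real) \<Rightarrow> real^'p \<Rightarrow> real^'p^'p" where
  "hess g \<theta> = jacobian (grad g) (at \<theta>)"

definition twice_differentiable :: "(real^'p \<Rightarrow> real) \<Rightarrow> bool" where
  "twice_differentiable g \<longleftrightarrow>
     (\<forall>\<theta>. g differentiable (at \<theta>)) \<and> (\<forall>\<theta>. grad g differentiable (at \<theta>))"

definition outer :: "real^'p \<Rightarrow> real^'p \<Rightarrow> real^'p^'p" where
  "outer u v = (\<chi> i j. u $ i * v $ j)"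

text \<open>The Frobenius norm needs no definition: it is the norm of the type \<^typ>\<open>real^'p^'p\<close>.\<close>

lemma norm_matrix_eq_frobenius:
  fixes A :: "real^'p^'q"
  shows "norm A = sqrt (\<Sum>i\<in>UNIV. \<Sum>j\<in>UNIV. (A $ i $ j)\<^sup>2)"
  by (simp add: norm_vec_def L2_set_def sum_nonneg)

text \<open>
  The training data are \<open>(x i, y i)\<close> for \<open>i \<in> {1..n}\<close>; a model is a function \<open>f\<close> of an
  input and a parameter vector.
\<close>

definition sample_loss ::
  "('x \<Rightarrow> real^'p \<Rightarrow> real) \<Rightarrow> (nat \<Rightarrow> 'x) \<Rightarrow> (nat \<Rightarrow> real) \<Rightarrow> nat \<Rightarrow> real^'p \<Rightarrow> real" where
  "sample_loss f x y i \<theta> = 1 / 2 * \<bar>f (x i) \<theta> - y i\<bar>\<^sup>2"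

definition loss ::
  "nat \<Rightarrow> ('x \<Rightarrow> real^'p \<Rightarrow> real) \<Rightarrow> (nat \<Rightarrow> 'x) \<Rightarrow> (nat \<Rightarrow> real) \<Rightarrow> real^'p \<Rightarrow> real" where
  "loss n f x y \<theta> = 1 / real n * (\<Sum>i=1..n. sample_loss f x y i \<theta>)"

definition fisher ::
  "nat \<Rightarrow> ('x \<Rightarrow> real^'p \<Rightarrow> real) \<Rightarrow> (nat \<Rightarrow> 'x) \<Rightarrow> real^'p \<Rightarrow> real^'p^'p" where
  "fisher n f x \<theta> =
     (1 / real n) *\<^sub>R (\<Sum>i=1..n. outer (grad (f (x i)) \<theta>) (grad (f (x i)) \<theta>))"

definition loss_hessian ::
  "nat \<Rightarrow> ('x \<Rightarrow> real^'p \<Rightarrow> real) \<Rightarrow> (nat \<Rightarrow> 'x) \<Rightarrow> (nat \<Rightarrow> real) \<Rightarrow> real^'p \<Rightarrow> real^'p^'p" where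
  "loss_hessian n f x y \<theta> =
     fisher n f x \<theta> + (1 / real n) *\<^sub>R (\<Sum>i=1..n. (f (x i) \<theta> - y i) *\<^sub>R hess (f (x i)) \<theta>)"

definition noise_cov ::
  "nat \<Rightarrow> ('x \<Rightarrow> real^'p \<Rightarrow> real) \<Rightarrow> (nat \<Rightarrow> 'x) \<Rightarrow> (nat \<Rightarrow> real) \<Rightarrow> real^'p \<Rightarrow> real^'p^'p" where
  "noise_cov n f x y \<theta> = (1 / real n) *\<^sub>R
     (\<Sum>i=1..n. outer (grad (sample_loss f x y i) \<theta> - grad (loss n f x y) \<theta>)
                     (grad (sample_loss f x y i) \<theta> - grad (loss n f x y) \<theta>))"

definition batch_loss ::
  "nat \<Rightarrow> (nat \<Rightarrow> real^'p \<Rightarrow> real) \<Rightarrow> (nat \<Rightarrow> nat) \<Rightarrow> real^'p \<Rightarrow> real" where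
  "batch_loss B l b \<theta> = 1 / real B * (\<Sum>j=1..B. l (b j) \<theta>)"

text \<open>
  The SAM iterates for per-sample losses \<open>l\<close> and one realization \<open>b\<close> of all batches:
  \<open>b t 1\<close> is the batch of the descent step at time \<open>t\<close>, and \<open>b t 2\<close> that of the perturbation.
\<close>

primrec sam ::
  "real \<Rightarrow> real \<Rightarrow> nat \<Rightarrow> (nat \<Rightarrow> real^'p \<Rightarrow> real) \<Rightarrow> (nat \<Rightarrow> nat \<Rightarrow> nat \<Rightarrow> nat) \<Rightarrow> real^'p
   \<Rightarrow> nat \<Rightarrow> real^'p" where
  "sam \<eta> \<rho> B l b \<theta>0 0 = \<theta>0"
| "sam \<eta> \<rho> B l b \<theta>0 (Suc t) =
     (let \<theta> = sam \<eta> \<rho> B l b \<theta>0 t in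
      \<theta> - \<eta> *\<^sub>R grad (batch_loss B l (b t 1)) (\<theta> + \<rho> *\<^sub>R grad (batch_loss B l (b t 2)) \<theta>))"

text \<open>
  \<open>\<xi> t k j\<close> is the \<open>j\<close>-th index of the batch \<open>k \<in> {1, 2}\<close> at time \<open>t\<close>.  Independent batches of
  independently drawn indices amount to joint independence of all these indices.
\<close>

definition random_batches ::
  "'w measure \<Rightarrow> nat \<Rightarrow> nat \<Rightarrow> (nat \<Rightarrow> nat \<Rightarrow> nat \<Rightarrow> 'w \<Rightarrow> nat) \<Rightarrow> bool" where
  "random_batches M n B \<xi> \<longleftrightarrow>
     prob_space M \<and>
     prob_space.indep_vars M (\<lambda>_. count_space UNIV) (\<lambda>(t, k, j). \<xi> t k j) (UNIV \<times> {1, 2} \<times> {1..B}) \<and>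
     (\<forall>t. \<forall>k\<in>{1, 2}. \<forall>j\<in>{1..B}.
        distr M (count_space UNIV) (\<xi> t k j) = measure_pmf (pmf_of_set {1..n}))"

definition lin_model ::
  "('x \<Rightarrow> real^'p \<Rightarrow> real) \<Rightarrow> real^'p \<Rightarrow> 'x \<Rightarrow> real^'p \<Rightarrow> real" where
  "lin_model f \<theta>s u \<theta> = f u \<theta>s + grad (f u) \<theta>s \<bullet> (\<theta> - \<theta>s)"

text \<open>
  The property depends on \<open>M\<close> and \<open>\<xi>\<close> only through the joint law of the batches, which
  \<^const>\<open>random_batches\<close> determines.
\<close>

definition linearly_stable ::
  "'w measure \<Rightarrow> (nat \<Rightarrow> nat \<Rightarrow> nat \<Rightarrow> 'w \<Rightarrow> nat) \<Rightarrow> real \<Rightarrow> real \<Rightarrow> nat \<Rightarrow> nat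
   \<Rightarrow> ('x \<Rightarrow> real^'p \<Rightarrow> real) \<Rightarrow> (nat \<Rightarrow> 'x) \<Rightarrow> (nat \<Rightarrow> real) \<Rightarrow> real^'p \<Rightarrow> bool" where
  "linearly_stable M \<xi> \<eta> \<rho> B n f x y \<theta>s \<longleftrightarrow>
     (let f_lin = lin_model f \<theta>s;
          \<Theta> = (\<lambda>\<theta>0 t \<omega>. sam \<eta> \<rho> B (sample_loss f_lin x y) (\<lambda>t k j. \<xi> t k j \<omega>) \<theta>0 t)
      in \<exists>C>0. \<exists>U. open U \<and> \<theta>s \<in> U \<and>
           (\<forall>\<theta>0\<in>U. \<forall>t. (\<integral>\<omega>. loss n f_lin x y (\<Theta> \<theta>0 t \<omega>) \<partial>M)
                        \<le> C * (\<integral>\<omega>. loss n f_lin x y (\<Theta> \<theta>0 0 \<omega>) \<partial>M)))"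

end

(*
  On the linearized model the loss is a quadratic form in v = \<theta> - \<theta>s. Averaging over the descent
  batch, the loss after one step is at least the contribution of the gradient noise, because the
  mean step contributes a square; averaging over the perturbation batch, the perturbation does not
  decrease the loss on average and adds its own noise. A second-order expansion of the noise
  hypothesis at the minimum bounds both noise terms below by the loss, so the expected loss grows
  at least geometrically, with ratio
  \<eta>^2 \<gamma> |H|^2 / B * (1 + \<rho>^2 \<gamma> |H|^2 / B), and stability forces this ratio to be at most 1.
*)

theory Submission
  imports Defs
begin

section \<open>Averages over finite sets and finite products\<close>

text \<open>Expectations over the random batches are reduced to these plain averages over index
  functions. Over an empty or infinite set the value is 0 because \<open>card\<close> is 0 there, so
  the algebraic rules hold without finiteness; only the average of a constant needs a finite
  nonempty set.\<close>

definition avg :: "'a set \<Rightarrow> ('a \<Rightarrow> real) \<Rightarrow> real" where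
  "avg A F = (\<Sum>a\<in>A. F a) / real (card A)"

lemma avg_cong: "(\<And>a. a \<in> A \<Longrightarrow> F a = G a) \<Longrightarrow> avg A F = avg A G"
  by (simp add: avg_def)

lemma avg_nonneg: "(\<And>a. a \<in> A \<Longrightarrow> 0 \<le> F a) \<Longrightarrow> 0 \<le> avg A F"
  by (simp add: avg_def sum_nonneg)

lemma avg_add: "avg A (\<lambda>a. F a + G a) = avg A F + avg A G"
  by (simp add: avg_def sum.distrib add_divide_distrib)

lemma avg_diff: "avg A (\<lambda>a. F a - G a) = avg A F - avg A G"
  by (simp add: avg_def sum_subtractf diff_divide_distrib)

lemma avg_cmult: "avg A (\<lambda>a. c * F a) = c * avg A F"
  by (simp add: avg_def sum_distrib_left)

lemma avg_const: "finite A \<Longrightarrow> A \<noteq> {} \<Longrightarrow> avg A (\<lambda>_. c) = c"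
  by (simp add: avg_def)

lemma avg_swap: "avg A (\<lambda>a. avg B (F a)) = avg B (\<lambda>b. avg A (\<lambda>a. F a b))"
  by (simp add: avg_def sum_divide_distrib[symmetric] sum.swap[of _ A B])

text \<open>Splitting off the value at \<open>k\<close> is a bijection between functions on
  \<open>insert k K\<close> and pairs, so an average over a product can be taken one draw at a
  time.\<close>

lemma avg_PiE_insert:
  assumes "k \<notin> K"
  shows "avg (insert k K \<rightarrow>\<^sub>E S) F = avg S (\<lambda>a. avg (K \<rightarrow>\<^sub>E S) (\<lambda>b. F (b(k := a))))"
proof -
  have inj: "inj_on (\<lambda>(a, b). b(k := a)) (S \<times> (K \<rightarrow>\<^sub>E S))"
    using inj_combinator[OF assms] .
  have "(\<Sum>b\<in>insert k K \<rightarrow>\<^sub>E S. F b) = (\<Sum>(a, b)\<in>S \<times> (K \<rightarrow>\<^sub>E S). F (b(k := a)))"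
    unfolding PiE_insert_eq by (subst sum.reindex[OF inj]) (simp add: case_prod_unfold)
  moreover have "card (insert k K \<rightarrow>\<^sub>E S) = card S * card (K \<rightarrow>\<^sub>E S)"
    unfolding PiE_insert_eq by (subst card_image[OF inj]) (simp add: card_cartesian_product)
  ultimately show ?thesis
    by (simp add: avg_def sum.cartesian_product sum_divide_distrib[symmetric] field_simps)
qed

text \<open>Fubini for two disjoint blocks of indices. Gluing by \<open>override_on\<close> matches
  the later use, where a fresh batch on \<open>K\<close> is written over a given history.\<close>

lemma avg_PiE_Un:
  assumes "I \<inter> K = {}"
  shows "avg (I \<union> K \<rightarrow>\<^sub>E S) F
    = avg (I \<rightarrow>\<^sub>E S) (\<lambda>a. avg (K \<rightarrow>\<^sub>E S) (\<lambda>b. F (override_on a b K)))"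
proof -
  let ?m = "\<lambda>(a, b). override_on a b K"
  have bij: "bij_betw ?m ((I \<rightarrow>\<^sub>E S) \<times> (K \<rightarrow>\<^sub>E S)) (I \<union> K \<rightarrow>\<^sub>E S)"
  proof (rule bij_betw_byWitness[where f' = "\<lambda>c. (restrict c I, restrict c K)"])
    show "\<forall>p\<in>(I \<rightarrow>\<^sub>E S) \<times> (K \<rightarrow>\<^sub>E S). (restrict (?m p) I, restrict (?m p) K) = p"
    proof
      fix p assume "p \<in> (I \<rightarrow>\<^sub>E S) \<times> (K \<rightarrow>\<^sub>E S)"
      then obtain a b where "p = (a, b)" "a \<in> I \<rightarrow>\<^sub>E S" "b \<in> K \<rightarrow>\<^sub>E S" by auto
      then show "(restrict (?m p) I, restrict (?m p) K) = p"
        using assms by (auto simp: fun_eq_iff override_on_def PiE_def extensional_def)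
    qed
    show "\<forall>c\<in>I \<union> K \<rightarrow>\<^sub>E S. ?m (restrict c I, restrict c K) = c"
      by (auto simp: fun_eq_iff override_on_def PiE_def extensional_def)
    show "?m ` ((I \<rightarrow>\<^sub>E S) \<times> (K \<rightarrow>\<^sub>E S)) \<subseteq> (I \<union> K \<rightarrow>\<^sub>E S)"
      using assms by (auto simp: override_on_def PiE_def extensional_def Pi_def)
    show "(\<lambda>c. (restrict c I, restrict c K)) ` (I \<union> K \<rightarrow>\<^sub>E S) \<subseteq> (I \<rightarrow>\<^sub>E S) \<times> (K \<rightarrow>\<^sub>E S)"
      by auto
  qed
  have "(\<Sum>c\<in>I \<union> K \<rightarrow>\<^sub>E S. F c) = (\<Sum>(a, b)\<in>(I \<rightarrow>\<^sub>E S) \<times> (K \<rightarrow>\<^sub>E S). F (override_on a b K))"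
    using sum.reindex_bij_betw[OF bij, of F] by (simp add: case_prod_unfold)
  moreover have "card (I \<union> K \<rightarrow>\<^sub>E S) = card (I \<rightarrow>\<^sub>E S) * card (K \<rightarrow>\<^sub>E S)"
    using bij_betw_same_card[OF bij] by (simp add: card_cartesian_product)
  ultimately show ?thesis
    by (simp add: avg_def sum.cartesian_product sum_divide_distrib[symmetric] field_simps)
qed

text \<open>Second moment as squared mean plus variance for a sum of \<open>card K\<close>
  independent uniform draws: the variances add up because the deviation of each new draw from the
  mean averages to 0.\<close>

lemma avg_square_add_sum:
  fixes h :: "'a \<Rightarrow> real"
  assumes "finite K" "finite S" "S \<noteq> {}"
  shows "avg (K \<rightarrow>\<^sub>E S) (\<lambda>b. (c + s * (\<Sum>k\<in>K. h (b k)))\<^sup>2)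
    = (c + s * real (card K) * avg S h)\<^sup>2 + s\<^sup>2 * real (card K) * avg S (\<lambda>a. (h a - avg S h)\<^sup>2)"
  using assms(1)
proof (induction K arbitrary: c rule: finite_induct)
  case empty
  then show ?case by (simp add: avg_def)
next
  case (insert k K)
  let ?\<mu> = "avg S h" and ?r = "real (card K)"
  let ?V = "avg S (\<lambda>a. (h a - ?\<mu>)\<^sup>2)"
  have "avg (insert k K \<rightarrow>\<^sub>E S) (\<lambda>b. (c + s * (\<Sum>k\<in>insert k K. h (b k)))\<^sup>2)
      = avg S (\<lambda>a. avg (K \<rightarrow>\<^sub>E S) (\<lambda>b. ((c + s * h a) + s * (\<Sum>k\<in>K. h (b k)))\<^sup>2))"
    unfolding avg_PiE_insert[OF insert.hyps(2)]
  proof (intro avg_cong)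
    fix a b
    have "(\<Sum>i\<in>K. h ((b(k := a)) i)) = (\<Sum>i\<in>K. h (b i))"
      using insert.hyps by (intro sum.cong) auto
    then show "(c + s * (\<Sum>i\<in>insert k K. h ((b(k := a)) i)))\<^sup>2
      = ((c + s * h a) + s * (\<Sum>i\<in>K. h (b i)))\<^sup>2"
      using insert.hyps by (simp add: algebra_simps)
  qed
  also have "\<dots> = avg S (\<lambda>a. (c + s * h a + s * ?r * ?\<mu>)\<^sup>2 + s\<^sup>2 * ?r * ?V)"
    by (simp add: insert.IH)
  \<comment> \<open>The new draw is split into its mean and its deviation; the term linear in the
    deviation vanishes under the average.\<close>
  also have "\<dots> = avg S (\<lambda>a. (c + s * (?r + 1) * ?\<mu>)\<^sup>2
      + 2 * (c + s * (?r + 1) * ?\<mu>) * s * (h a - ?\<mu>) + s\<^sup>2 * (h a - ?\<mu>)\<^sup>2 + s\<^sup>2 * ?r * ?V)"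
    by (intro avg_cong) (simp add: power2_eq_square algebra_simps)
  also have "\<dots> = (c + s * (?r + 1) * ?\<mu>)\<^sup>2 + s\<^sup>2 * (?r + 1) * ?V"
    using assms by (simp add: avg_add avg_diff avg_cmult avg_const) (simp add: algebra_simps)
  finally show ?case
    using insert.hyps by (simp add: algebra_simps)
qed

section \<open>Expectations of functions of finitely many independent uniform coordinates\<close>

context prob_space
begin

text \<open>\<open>F\<close> takes a full stream of indices, so that it can be a SAM trajectory as
  it stands; \<open>dep\<close> expresses that it reads only the finitely many coordinates in
  \<open>I\<close>.\<close>

context
  fixes X :: "'i \<Rightarrow> 'a \<Rightarrow> 'b::countable" and J I :: "'i set" and S :: "'b set"
    and F :: "('i \<Rightarrow> 'b) \<Rightarrow> real"
  assumes indep: "indep_vars (\<lambda>_. count_space UNIV) X J"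
    and unif: "\<And>i. i \<in> J \<Longrightarrow> distr M (count_space UNIV) (X i) = measure_pmf (pmf_of_set S)"
    and S: "finite S" "S \<noteq> {}"
    and I: "finite I" "I \<subseteq> J"
    and dep: "\<And>b b'. (\<And>i. i \<in> I \<Longrightarrow> b i = b' i) \<Longrightarrow> F b = F b'"
begin

lemma measurable_coords: "i \<in> J \<Longrightarrow> X i \<in> measurable M (count_space UNIV)"
  using indep by (auto simp: indep_vars_def)

lemma prob_coord:
  assumes "i \<in> J" "c \<in> S"
  shows "prob (X i -` {c} \<inter> space M) = 1 / real (card S)"
proof -
  have "prob (X i -` {c} \<inter> space M) = measure (distr M (count_space UNIV) (X i)) {c}"
    by (subst measure_distr) (auto intro: measurable_coords assms)
  also have "\<dots> = pmf (pmf_of_set S) c"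
    using assms by (simp add: unif pmf.rep_eq)
  also have "\<dots> = 1 / real (card S)"
    using S assms by simp
  finally show ?thesis .
qed

lemma AE_coord:
  assumes "i \<in> J"
  shows "AE \<omega> in M. X i \<omega> \<in> S"
proof -
  have "AE c in distr M (count_space UNIV) (X i). c \<in> S"
    using S unfolding unif[OF assms] by (simp add: AE_measure_pmf_iff)
  then show ?thesis
    by (subst (asm) AE_distr_iff) (auto intro: measurable_coords assms)
qed

lemma prob_coords:
  assumes "b \<in> I \<rightarrow>\<^sub>E S"
  shows "prob {\<omega> \<in> space M. \<forall>i\<in>I. X i \<omega> = b i} = 1 / real (card (I \<rightarrow>\<^sub>E S))"
\<comment> \<open>The product rule of \<open>indep_varsD\<close> is stated for nonempty index
  sets.\<close>
proof (cases "I = {}")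
  case True
  then show ?thesis by (simp add: prob_space)
next
  case False
  have "{\<omega> \<in> space M. \<forall>i\<in>I. X i \<omega> = b i} = (\<Inter>i\<in>I. X i -` {b i} \<inter> space M)"
    using False by auto
  then have "prob {\<omega> \<in> space M. \<forall>i\<in>I. X i \<omega> = b i} = (\<Prod>i\<in>I. prob (X i -` {b i} \<inter> space M))"
    using indep_varsD[OF indep False I, of "\<lambda>i. {b i}"] by simp
  also have "\<dots> = (\<Prod>i\<in>I. 1 / real (card S))"
    using assms I by (intro prod.cong refl prob_coord) auto
  finally show ?thesis
    using I S by (simp add: card_funcsetE power_one_over)
qed

text \<open>A finite product of discrete \<sigma>-algebras on a countable type is discrete, so every
  function of the restricted coordinates is measurable; by \<open>dep\<close> the restriction does
  not change the value.\<close>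

lemma measurable_of_coords: "(\<lambda>\<omega>. F (\<lambda>i. X i \<omega>)) \<in> borel_measurable M"
proof -
  have "(\<lambda>\<omega>. \<lambda>i\<in>I. X i \<omega>) \<in> measurable M (PiM I (\<lambda>_. count_space UNIV))"
    using I by (intro measurable_restrict measurable_coords) auto
  then have "(\<lambda>\<omega>. \<lambda>i\<in>I. X i \<omega>) \<in> measurable M (count_space (PiE I (\<lambda>_. UNIV)))"
    using count_space_PiM_finite[of I "\<lambda>_. UNIV :: 'b set"] I by simp
  then have "(\<lambda>\<omega>. F (\<lambda>i\<in>I. X i \<omega>)) \<in> borel_measurable M"
    by (rule measurable_compose) simp
  moreover have "F (\<lambda>i\<in>I. X i \<omega>) = F (\<lambda>i. X i \<omega>)" for \<omega>
    by (rule dep) simp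
  ultimately show ?thesis by simp
qed

lemma coords_events: "{\<omega> \<in> space M. \<forall>i\<in>I. X i \<omega> = b i} \<in> events"
proof -
  have "{\<omega> \<in> space M. X i \<omega> = b i} \<in> events" if "i \<in> I" for i
  proof -
    have "X i -` {b i} \<inter> space M \<in> events"
      using that I by (intro measurable_sets[OF measurable_coords]) auto
    moreover have "X i -` {b i} \<inter> space M = {\<omega> \<in> space M. X i \<omega> = b i}" by auto
    ultimately show ?thesis by simp
  qed
  then show ?thesis using I by (intro sets.sets_Collect_finite_All) auto
qed

lemma integrable_coords_indicator:
  "integrable M (indicator {\<omega> \<in> space M. \<forall>i\<in>I. X i \<omega> = b i} :: 'a \<Rightarrow> real)"
  using coords_events by (intro integrable_real_indicator) (auto simp: emeasure_eq_measure)

lemmas measurable_coords_indicator = borel_measurable_integrable[OF integrable_coords_indicator]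

text \<open>Almost surely all coordinates in \<open>I\<close> lie in \<open>S\<close>, and then
  exactly one \<open>b\<close> has an active indicator. This makes \<open>F\<close> a simple
  function up to a null set, from which integrability and expectation are read off.\<close>

lemma AE_of_coords:
  "AE \<omega> in M. F (\<lambda>i. X i \<omega>)
     = (\<Sum>b\<in>I \<rightarrow>\<^sub>E S. F b * indicator {\<omega> \<in> space M. \<forall>i\<in>I. X i \<omega> = b i} \<omega>)"
proof -
  have "AE \<omega> in M. \<forall>i\<in>I. X i \<omega> \<in> S"
    using I by (intro AE_finite_allI AE_coord) auto
  moreover have "AE \<omega> in M. \<omega> \<in> space M" by simp
  ultimately show ?thesis
  proof eventually_elim
    fix \<omega> assume \<omega>: "\<forall>i\<in>I. X i \<omega> \<in> S" "\<omega> \<in> space M"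
    let ?b = "\<lambda>i\<in>I. X i \<omega>"
    have "(\<forall>i\<in>I. X i \<omega> = b i) \<longleftrightarrow> b = ?b" if "b \<in> I \<rightarrow>\<^sub>E S" for b
      using that by (auto simp: fun_eq_iff PiE_def extensional_def)
    then have "(\<Sum>b\<in>I \<rightarrow>\<^sub>E S. F b * indicator {\<omega> \<in> space M. \<forall>i\<in>I. X i \<omega> = b i} \<omega>)
        = (\<Sum>b\<in>I \<rightarrow>\<^sub>E S. if b = ?b then F b else 0)"
      using \<omega> by (intro sum.cong) (auto simp: indicator_def)
    also have "\<dots> = F ?b"
      using \<omega> I S by (subst sum.delta) (auto intro: finite_PiE)
    also have "\<dots> = F (\<lambda>i. X i \<omega>)" by (rule dep) simp
    finally show "F (\<lambda>i. X i \<omega>)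
     = (\<Sum>b\<in>I \<rightarrow>\<^sub>E S. F b * indicator {\<omega> \<in> space M. \<forall>i\<in>I. X i \<omega> = b i} \<omega>)" by simp
  qed
qed

lemma integrable_of_coords: "integrable M (\<lambda>\<omega>. F (\<lambda>i. X i \<omega>))"
proof (subst integrable_cong_AE[OF _ _ AE_of_coords])
  show "integrable M (\<lambda>\<omega>. \<Sum>b\<in>I \<rightarrow>\<^sub>E S.
      F b * indicator {\<omega> \<in> space M. \<forall>i\<in>I. X i \<omega> = b i} \<omega>)"
    by (intro Bochner_Integration.integrable_sum integrable_mult_right integrable_coords_indicator)
qed (auto intro!: measurable_of_coords measurable_coords_indicator borel_measurable_sum
      borel_measurable_times)

lemma expectation_of_coords: "expectation (\<lambda>\<omega>. F (\<lambda>i. X i \<omega>)) = avg (I \<rightarrow>\<^sub>E S) F"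
proof -
  let ?A = "\<lambda>b. {\<omega> \<in> space M. \<forall>i\<in>I. X i \<omega> = b i}"
  have "expectation (\<lambda>\<omega>. F (\<lambda>i. X i \<omega>))
      = expectation (\<lambda>\<omega>. \<Sum>b\<in>I \<rightarrow>\<^sub>E S. F b * indicator (?A b) \<omega>)"
    by (intro integral_cong_AE AE_of_coords measurable_of_coords)
      (auto intro!: measurable_coords_indicator borel_measurable_sum borel_measurable_times)
  also have "\<dots> = (\<Sum>b\<in>I \<rightarrow>\<^sub>E S. F b * prob (?A b))"
    by (subst Bochner_Integration.integral_sum)
      (auto intro!: integrable_coords_indicator sum.cong arg_cong[of _ _ prob])
  also have "\<dots> = avg (I \<rightarrow>\<^sub>E S) F"
    by (simp add: avg_def prob_coords sum_divide_distrib)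
  finally show ?thesis .
qed

end

text \<open>Integrating out the coordinates in \<open>K\<close> while the others stay random. This
  plays the part of conditioning on the past: both sides equal the same iterated finite
  average.\<close>

lemma expectation_of_coords_Un:
  fixes X :: "'i \<Rightarrow> 'a \<Rightarrow> 'b::countable"
  assumes indep: "indep_vars (\<lambda>_. count_space UNIV) X J"
    and unif: "\<And>i. i \<in> J \<Longrightarrow> distr M (count_space UNIV) (X i) = measure_pmf (pmf_of_set S)"
    and S: "finite S" "S \<noteq> {}"
    and IK: "finite I" "finite K" "I \<union> K \<subseteq> J" "I \<inter> K = {}"
    and dep: "\<And>b b'. (\<And>i. i \<in> I \<union> K \<Longrightarrow> b i = b' i) \<Longrightarrow> F b = F b'"
  shows "expectation (\<lambda>\<omega>. F (\<lambda>i. X i \<omega>))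
    = expectation (\<lambda>\<omega>. avg (K \<rightarrow>\<^sub>E S) (\<lambda>b. F (override_on (\<lambda>i. X i \<omega>) b K)))"
proof -
  have "expectation (\<lambda>\<omega>. F (\<lambda>i. X i \<omega>)) = avg (I \<union> K \<rightarrow>\<^sub>E S) F"
    using IK by (intro expectation_of_coords[OF indep unif S _ _ dep]) auto
  also have "\<dots> = avg (I \<rightarrow>\<^sub>E S) (\<lambda>a. avg (K \<rightarrow>\<^sub>E S) (\<lambda>b. F (override_on a b K)))"
    by (rule avg_PiE_Un) fact
  also have "\<dots> = expectation (\<lambda>\<omega>. avg (K \<rightarrow>\<^sub>E S) (\<lambda>b. F (override_on (\<lambda>i. X i \<omega>) b K)))"
    using IK by (intro expectation_of_coords[OF indep unif S, symmetric] avg_cong dep)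
      (auto simp: override_on_def)
  finally show ?thesis .
qed

end

section \<open>Energy, Gram operator and noise of the linearized model\<close>

text \<open>For \<open>g i\<close> the gradient of the model at \<open>x i\<close> in \<open>\<theta>s\<close>, and the linearized model at \<open>\<theta>s + v\<close>,
  \<open>energy n g v\<close> is twice the loss, \<open>gram n g v\<close> is \<open>G v\<close>, and \<open>noise_energy n g v\<close> is
  \<open>Tr (\<Sigma> G)\<close>.\<close>

definition energy :: "nat \<Rightarrow> (nat \<Rightarrow> real^'p) \<Rightarrow> real^'p \<Rightarrow> real" where
  "energy n g v = avg {1..n} (\<lambda>i. (g i \<bullet> v)\<^sup>2)"

definition gram :: "nat \<Rightarrow> (nat \<Rightarrow> real^'p) \<Rightarrow> real^'p \<Rightarrow> real^'p" where
  "gram n g v = (1 / real n) *\<^sub>R (\<Sum>i=1..n. (g i \<bullet> v) *\<^sub>R g i)"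

definition noise_energy :: "nat \<Rightarrow> (nat \<Rightarrow> real^'p) \<Rightarrow> real^'p \<Rightarrow> real" where
  "noise_energy n g v = avg {1..n} (\<lambda>i. energy n g ((g i \<bullet> v) *\<^sub>R g i - gram n g v))"

lemma energy_nonneg: "0 \<le> energy n g v"
  by (simp add: energy_def avg_nonneg)

lemma inner_gram: "u \<bullet> gram n g v = avg {1..n} (\<lambda>i. (g i \<bullet> u) * (g i \<bullet> v))"
  by (simp add: gram_def avg_def inner_sum_right inner_commute mult.commute)

text \<open>\<open>gram n g v\<close> is an ascent direction: the cross term of the square averages
  to \<open>2 * \<rho>\<close> times the squared norm of \<open>gram n g v\<close>, and the
  remaining term is an energy.\<close>

lemma energy_le_energy_add_gram:
  assumes "0 \<le> \<rho>"
  shows "energy n g v \<le> energy n g (v + \<rho> *\<^sub>R gram n g v)"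
proof -
  have "energy n g (v + \<rho> *\<^sub>R gram n g v)
      = avg {1..n} (\<lambda>i. (g i \<bullet> v)\<^sup>2 + (2 * \<rho>) * ((g i \<bullet> gram n g v) * (g i \<bullet> v))
          + \<rho>\<^sup>2 * (g i \<bullet> gram n g v)\<^sup>2)"
    unfolding energy_def
    by (intro avg_cong) (simp add: inner_add_right power2_eq_square algebra_simps)
  also have "\<dots> = energy n g v + 2 * \<rho> * (gram n g v \<bullet> gram n g v)
      + \<rho>\<^sup>2 * energy n g (gram n g v)"
    by (simp add: avg_add avg_cmult energy_def inner_gram)
  finally show ?thesis
    using assms energy_nonneg[of n g] by simp
qed

text \<open>One stochastic gradient step from \<open>v\<close>, with gradients taken at
  \<open>w\<close>: the mean step plus the sampling noise. It serves the descent step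
  (\<open>s = - \<eta> / real B\<close>, \<open>w\<close> the perturbed point) as well as the
  perturbation (\<open>s = \<rho> / real B\<close>, \<open>w = v\<close>).\<close>

lemma avg_energy_step:
  assumes "finite K" "n \<ge> 1"
  shows "avg (K \<rightarrow>\<^sub>E {1..n}) (\<lambda>b. energy n g (v + s *\<^sub>R (\<Sum>k\<in>K. (g (b k) \<bullet> w) *\<^sub>R g (b k))))
    = energy n g (v + (s * real (card K)) *\<^sub>R gram n g w) + s\<^sup>2 * real (card K) * noise_energy n g w"
proof -
  let ?S = "{1..n}" and ?r = "real (card K)"
  have "avg (K \<rightarrow>\<^sub>E ?S) (\<lambda>b. (g i \<bullet> (v + s *\<^sub>R (\<Sum>k\<in>K. (g (b k) \<bullet> w) *\<^sub>R g (b k))))\<^sup>2)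
      = (g i \<bullet> (v + (s * ?r) *\<^sub>R gram n g w))\<^sup>2
        + s\<^sup>2 * ?r * avg ?S (\<lambda>a. (g i \<bullet> ((g a \<bullet> w) *\<^sub>R g a - gram n g w))\<^sup>2)" for i
    \<comment> \<open>Tested against a fixed \<open>g i\<close>, the step is a scalar sum of draws
      whose mean is \<open>g i \<bullet> gram n g w\<close> by \<open>inner_gram\<close>. Averaging
      over \<open>i\<close> then restores the energy.\<close>
    using avg_square_add_sum[of K ?S "g i \<bullet> v" s "\<lambda>a. (g a \<bullet> g i) * (g a \<bullet> w)"] assms
    by (simp add: inner_gram inner_add_right inner_sum_right inner_diff_right
        inner_commute mult.commute)
  moreover have "noise_energy n g w
      = avg ?S (\<lambda>i. avg ?S (\<lambda>a. (g i \<bullet> ((g a \<bullet> w) *\<^sub>R g a - gram n g w))\<^sup>2))"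
    unfolding noise_energy_def energy_def by (rule avg_swap)
  ultimately show ?thesis
    unfolding energy_def by (subst avg_swap) (simp add: avg_add avg_cmult)
qed

section \<open>Gradients of the losses; causality of SAM\<close>

lemma grad_eqI:
  assumes "(h has_derivative (\<lambda>v. d \<bullet> v)) (at \<theta>)"
  shows "grad h \<theta> = d"
proof -
  have "frechet_derivative h (at \<theta>) = (\<lambda>v. d \<bullet> v)"
    using frechet_derivative_at[OF assms] by simp
  then show ?thesis
    by (simp add: grad_def vec_eq_iff inner_axis)
qed

text \<open>\<open>grad\<close> records the derivative on the axis vectors only; by linearity these
  values determine it.\<close>

lemma has_derivative_grad:
  assumes "h differentiable (at \<theta>)"
  shows "(h has_derivative (\<lambda>v. grad h \<theta> \<bullet> v)) (at \<theta>)"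
proof -
  let ?D = "frechet_derivative h (at \<theta>)"
  have D: "(h has_derivative ?D) (at \<theta>)"
    using assms frechet_derivative_works by blast
  then have "linear ?D" by (rule has_derivative_linear)
  have "?D v = grad h \<theta> \<bullet> v" for v
  proof -
    have "?D v = ?D (\<Sum>j\<in>UNIV. v $ j *\<^sub>R axis j 1)"
      by (simp add: basis_expansion scalar_mult_eq_scaleR[symmetric])
    also have "\<dots> = (\<Sum>j\<in>UNIV. v $ j *\<^sub>R ?D (axis j 1))"
      using \<open>linear ?D\<close> by (simp add: linear_sum linear_scale)
    finally show ?thesis
      by (simp add: grad_def inner_vec_def mult.commute)
  qed
  then have "?D = (\<lambda>v. grad h \<theta> \<bullet> v)" by auto
  with D show ?thesis by simp
qed

lemma grad_sample_loss:
  assumes "f (x i) differentiable (at \<theta>)"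
  shows "grad (sample_loss f x y i) \<theta> = (f (x i) \<theta> - y i) *\<^sub>R grad (f (x i)) \<theta>"
    and "sample_loss f x y i differentiable (at \<theta>)"
proof -
  have "(sample_loss f x y i has_derivative
      (\<lambda>v. ((f (x i) \<theta> - y i) *\<^sub>R grad (f (x i)) \<theta>) \<bullet> v)) (at \<theta>)"
    unfolding sample_loss_def[abs_def] power2_abs
    by (auto intro!: derivative_eq_intros has_derivative_grad[OF assms])
  then show "grad (sample_loss f x y i) \<theta> = (f (x i) \<theta> - y i) *\<^sub>R grad (f (x i)) \<theta>"
    "sample_loss f x y i differentiable (at \<theta>)"
    by (auto intro: grad_eqI differentiableI)
qed

lemma grad_cmult_sum:
  assumes "\<And>j. j \<in> J \<Longrightarrow> h j differentiable (at \<theta>)"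
  shows "grad (\<lambda>\<theta>. c * (\<Sum>j\<in>J. h j \<theta>)) \<theta> = c *\<^sub>R (\<Sum>j\<in>J. grad (h j) \<theta>)"
  by (rule grad_eqI)
    (auto intro!: derivative_eq_intros has_derivative_grad assms
      simp: inner_sum_left sum_distrib_left)

lemma grad_loss:
  assumes "\<And>i. i \<in> {1..n} \<Longrightarrow> f (x i) differentiable (at \<theta>)"
  shows "grad (loss n f x y) \<theta>
    = (1 / real n) *\<^sub>R (\<Sum>i=1..n. (f (x i) \<theta> - y i) *\<^sub>R grad (f (x i)) \<theta>)"
  unfolding loss_def[abs_def] using assms
  by (subst grad_cmult_sum) (auto intro: grad_sample_loss simp: grad_sample_loss)

lemma lin_model_differentiable: "lin_model f \<theta>s u differentiable (at \<theta>)"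
  and grad_lin_model: "grad (lin_model f \<theta>s u) \<theta> = grad (f u) \<theta>s"
proof -
  have "(lin_model f \<theta>s u has_derivative (\<lambda>v. grad (f u) \<theta>s \<bullet> v)) (at \<theta>)"
    unfolding lin_model_def[abs_def] by (auto intro!: derivative_eq_intros)
  then show "lin_model f \<theta>s u differentiable (at \<theta>)"
    "grad (lin_model f \<theta>s u) \<theta> = grad (f u) \<theta>s"
    by (auto intro: grad_eqI differentiableI)
qed

lemma grad_batch_lin:
  "grad (batch_loss B (sample_loss (lin_model f \<theta>s) x y) b) \<theta>
    = (1 / real B) *\<^sub>R
      (\<Sum>j=1..B. (lin_model f \<theta>s (x (b j)) \<theta> - y (b j)) *\<^sub>R grad (f (x (b j))) \<theta>s)"
  unfolding batch_loss_def[abs_def]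
  by (subst grad_cmult_sum)
    (auto intro!: grad_sample_loss lin_model_differentiable
      simp: grad_sample_loss(1)[OF lin_model_differentiable] grad_lin_model)

text \<open>The iterate at time \<open>t\<close> reads only the batches drawn strictly before
  \<open>t\<close>. This is what makes it independent of the batches used in the next step.\<close>

lemma sam_cong:
  assumes "\<And>s k j. s < t \<Longrightarrow> k \<in> {1, 2} \<Longrightarrow> j \<in> {1..B} \<Longrightarrow> b s k j = b' s k j"
  shows "sam \<eta> \<rho> B l b \<theta>0 t = sam \<eta> \<rho> B l b' \<theta>0 t"
  using assms
proof (induction t)
  case (Suc t)
  have "batch_loss B l (b t k) = batch_loss B l (b' t k)" if "k \<in> {1, 2}" for k
    using Suc.prems[of t k] that by (auto simp: batch_loss_def fun_eq_iff)
  moreover have "sam \<eta> \<rho> B l b \<theta>0 t = sam \<eta> \<rho> B l b' \<theta>0 t"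
    by (rule Suc.IH) (use Suc.prems in simp)
  ultimately show ?case by simp
qed simp

section \<open>The noise hypothesis near the minimum\<close>

text \<open>By bilinearity it comes down to one pair of rank-one matrices, whose product has trace
  \<open>(w \<bullet> u)\<^sup>2\<close>.\<close>

lemma trace_mult_sum_outer:
  fixes u w :: "nat \<Rightarrow> real^'p"
  shows "trace ((c *\<^sub>R (\<Sum>i\<in>I. outer (u i) (u i))) ** (d *\<^sub>R (\<Sum>k\<in>K. outer (w k) (w k))))
    = c * d * (\<Sum>i\<in>I. \<Sum>k\<in>K. (w k \<bullet> u i)\<^sup>2)"
proof -
  have "trace ((c *\<^sub>R (\<Sum>i\<in>I. outer (u i) (u i))) ** (d *\<^sub>R (\<Sum>k\<in>K. outer (w k) (w k))))
     = (\<Sum>a\<in>UNIV. \<Sum>b\<in>UNIV. \<Sum>i\<in>I. \<Sum>k\<in>K. c * d * ((w k $ a * u i $ a) * (w k $ b * u i $ b)))"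
    by (simp add: trace_def matrix_matrix_mult_def outer_def sum_distrib_left sum_distrib_right
        sum.swap[of _ K I] mult_ac)
  also have "\<dots> = (\<Sum>i\<in>I. \<Sum>k\<in>K. \<Sum>a\<in>UNIV. \<Sum>b\<in>UNIV.
      c * d * ((w k $ a * u i $ a) * (w k $ b * u i $ b)))"
    by (simp add: sum.swap[of _ I UNIV] sum.swap[of _ K UNIV])
  also have "\<dots> = c * d * (\<Sum>i\<in>I. \<Sum>k\<in>K. (w k \<bullet> u i)\<^sup>2)"
    by (simp add: inner_vec_def power2_eq_square sum_product) (simp add: sum_distrib_left)
  finally show ?thesis .
qed

lemma trace_noise_cov_fisher:
  "trace (noise_cov n f x y \<theta> ** fisher n f x \<theta>)
    = avg {1..n} (\<lambda>i. avg {1..n} (\<lambda>k.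
        (grad (f (x k)) \<theta> \<bullet> (grad (sample_loss f x y i) \<theta> - grad (loss n f x y) \<theta>))\<^sup>2))"
  by (simp add: noise_cov_def fisher_def trace_mult_sum_outer avg_def sum_divide_distrib[symmetric]
      power2_eq_square)

lemma fisher_nonzeroE:
  assumes "fisher n f x \<theta> \<noteq> 0"
  obtains i where "i \<in> {1..n}" "grad (f (x i)) \<theta> \<noteq> 0"
proof -
  have "fisher n f x \<theta> = 0" if "\<And>i. i \<in> {1..n} \<Longrightarrow> grad (f (x i)) \<theta> = 0"
    using that by (simp add: fisher_def outer_def vec_eq_iff)
  then show ?thesis using assms that by fastforce
qed

lemma tendsto_avg:
  assumes "\<And>i. i \<in> A \<Longrightarrow> ((\<lambda>e. h e i) \<longlongrightarrow> l i) \<F>"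
  shows "((\<lambda>e. avg A (h e)) \<longlongrightarrow> avg A l) \<F>"
  unfolding avg_def divide_inverse by (intro tendsto_intros assms)

lemma tendsto_outer:
  assumes "(u \<longlongrightarrow> a) \<F>" "(w \<longlongrightarrow> b) \<F>"
  shows "((\<lambda>e. outer (u e) (w e)) \<longlongrightarrow> outer a b) \<F>"
  unfolding outer_def by (intro vec_tendstoI) (simp, intro tendsto_intros assms)

text \<open>Blowing up the noise condition at the minimum: along \<open>\<theta>s + e v\<close> both sides are of order
  \<open>e\<^sup>2\<close>, and their leading coefficients are those of the linearized model.\<close>

lemma noise_energy_ge:
  fixes f :: "'x \<Rightarrow> real^'p \<Rightarrow> real"
  assumes diff: "\<And>i. i \<in> {1..n} \<Longrightarrow> twice_differentiable (f (x i))"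
    and fit: "\<And>i. i \<in> {1..n} \<Longrightarrow> f (x i) \<theta>s = y i"
    and noise: "\<And>\<theta>. trace (noise_cov n f x y \<theta> ** fisher n f x \<theta>)
              \<ge> 2 * \<gamma> * loss n f x y \<theta> * (norm (fisher n f x \<theta>))\<^sup>2"
  shows "\<gamma> * (norm (fisher n f x \<theta>s))\<^sup>2 * energy n (\<lambda>i. grad (f (x i)) \<theta>s) v
    \<le> noise_energy n (\<lambda>i. grad (f (x i)) \<theta>s) v"
proof -
  define g where "g i = grad (f (x i)) \<theta>s" for i
  define \<theta> where "\<theta> e = \<theta>s + e *\<^sub>R v" for e :: real
  \<comment> \<open>The residual divided by \<open>e\<close>. Its value at \<open>e = 0\<close> is
    immaterial, since all limits are taken on the punctured neighbourhood.\<close>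
  define r where "r e i = (f (x i) (\<theta> e) - y i) / e" for e i
  define p where "p e i = grad (f (x i)) (\<theta> e)" for e i
  have d1: "f (x i) differentiable (at \<theta>')" "grad (f (x i)) differentiable (at \<theta>')"
    if "i \<in> {1..n}" for i \<theta>' using diff[OF that] by (auto simp: twice_differentiable_def)
  have \<theta>: "(\<theta> \<longlongrightarrow> \<theta>s) (at 0)"
    unfolding \<theta>_def by (auto intro!: tendsto_eq_intros)
  have p: "((\<lambda>e. p e i) \<longlongrightarrow> g i) (at 0)" if "i \<in> {1..n}" for i
  proof -
    have "isCont (grad (f (x i))) \<theta>s"
      using d1(2)[OF that] by (rule differentiable_imp_continuous_within)
    then show ?thesis unfolding p_def g_def by (rule isCont_tendsto_compose[OF _ \<theta>])
  qed
  have r: "((\<lambda>e. r e i) \<longlongrightarrow> g i \<bullet> v) (at 0)" if "i \<in> {1..n}" for i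
  proof -
    have "(\<theta> has_derivative (\<lambda>e. e *\<^sub>R v)) (at 0)"
      unfolding \<theta>_def by (auto intro!: derivative_eq_intros)
    moreover have "(f (x i) has_derivative (\<lambda>w. g i \<bullet> w)) (at (\<theta> 0))"
      using has_derivative_grad[OF d1(1)[OF that]] by (simp add: \<theta>_def g_def)
    ultimately have "((\<lambda>e. f (x i) (\<theta> e)) has_derivative (\<lambda>e. g i \<bullet> (e *\<^sub>R v))) (at 0)"
      by (rule has_derivative_compose)
    then have "((\<lambda>e. f (x i) (\<theta> e)) has_field_derivative (g i \<bullet> v)) (at 0)"
      by (simp add: has_field_derivative_def mult_commute_abs)
    \<comment> \<open>Since the residual vanishes at \<open>\<theta>s\<close> by \<open>fit\<close>,
      the difference quotient of the chain rule is exactly \<open>r\<close>.\<close>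
    then show ?thesis
      using fit[OF that] by (simp add: has_field_derivative_iff r_def \<theta>_def)
  qed
  \<comment> \<open>The deviation of the sample gradient from the full gradient along the line, with
    one factor \<open>e\<close> removed.\<close>
  define u where "u e i = r e i *\<^sub>R p e i - (1 / real n) *\<^sub>R (\<Sum>j=1..n. r e j *\<^sub>R p e j)" for e i
  have u: "((\<lambda>e. u e i) \<longlongrightarrow> (g i \<bullet> v) *\<^sub>R g i - gram n g v) (at 0)" if "i \<in> {1..n}" for i
    unfolding u_def gram_def using that by (intro tendsto_intros r p)
  have fisher: "((\<lambda>e. fisher n f x (\<theta> e)) \<longlongrightarrow> fisher n f x \<theta>s) (at 0)"
    unfolding fisher_def using p[unfolded p_def g_def]
    by (intro tendsto_intros tendsto_outer)
  have lower: "((\<lambda>e. \<gamma> * avg {1..n} (\<lambda>i. (r e i)\<^sup>2) * (norm (fisher n f x (\<theta> e)))\<^sup>2)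
      \<longlongrightarrow> \<gamma> * energy n g v * (norm (fisher n f x \<theta>s))\<^sup>2) (at 0)"
    unfolding energy_def by (intro tendsto_intros tendsto_avg r fisher)
  have upper: "((\<lambda>e. avg {1..n} (\<lambda>i. avg {1..n} (\<lambda>k. (p e k \<bullet> u e i)\<^sup>2)))
      \<longlongrightarrow> noise_energy n g v) (at 0)"
    unfolding noise_energy_def energy_def by (intro tendsto_intros tendsto_avg p u)
  have "\<gamma> * avg {1..n} (\<lambda>i. (r e i)\<^sup>2) * (norm (fisher n f x (\<theta> e)))\<^sup>2
      \<le> avg {1..n} (\<lambda>i. avg {1..n} (\<lambda>k. (p e k \<bullet> u e i)\<^sup>2))" if "e \<noteq> 0" for e
  proof -
    have res: "f (x i) (\<theta> e) - y i = e * r e i" for i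
      using that by (simp add: r_def)
    have "2 * loss n f x y (\<theta> e) = e\<^sup>2 * avg {1..n} (\<lambda>i. (r e i)\<^sup>2)"
      by (simp add: loss_def sample_loss_def res avg_def power_mult_distrib
          sum_distrib_left[symmetric] sum_divide_distrib[symmetric])
    \<comment> \<open>Each sample gradient carries its residual as a factor and hence one
      \<open>e\<close>; the trace is quadratic in the noise, so \<open>e\<^sup>2\<close> cancels
      against the one in the loss.\<close>
    moreover have "grad (loss n f x y) (\<theta> e)
        = (1 / real n) *\<^sub>R (\<Sum>i=1..n. (e * r e i) *\<^sub>R p e i)"
      unfolding p_def res[symmetric] by (intro grad_loss d1)
    then have "grad (sample_loss f x y i) (\<theta> e) - grad (loss n f x y) (\<theta> e) = e *\<^sub>R u e i"
      if "i \<in> {1..n}" for i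
      using that d1 by (simp add: grad_sample_loss u_def p_def[symmetric] res
          scaleR_diff_right scaleR_sum_right mult_ac)
    then have "trace (noise_cov n f x y (\<theta> e) ** fisher n f x (\<theta> e))
        = avg {1..n} (\<lambda>i. avg {1..n} (\<lambda>k. e\<^sup>2 * (p e k \<bullet> u e i)\<^sup>2))"
      unfolding trace_noise_cov_fisher p_def[symmetric]
      by (intro avg_cong) (simp add: power_mult_distrib)
    ultimately have "e\<^sup>2 * (\<gamma> * avg {1..n} (\<lambda>i. (r e i)\<^sup>2) * (norm (fisher n f x (\<theta> e)))\<^sup>2)
      \<le> e\<^sup>2 * avg {1..n} (\<lambda>i. avg {1..n} (\<lambda>k. (p e k \<bullet> u e i)\<^sup>2))"
      using noise[of "\<theta> e"] by (simp add: avg_cmult mult_ac)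
    then show ?thesis using that by simp
  qed
  then have "\<forall>\<^sub>F e in at 0. \<gamma> * avg {1..n} (\<lambda>i. (r e i)\<^sup>2) * (norm (fisher n f x (\<theta> e)))\<^sup>2
      \<le> avg {1..n} (\<lambda>i. avg {1..n} (\<lambda>k. (p e k \<bullet> u e i)\<^sup>2))"
    by (auto simp: eventually_at_filter)
  from tendsto_le[OF _ upper lower this] show ?thesis
    by (simp add: g_def[abs_def] mult_ac)
qed

section \<open>The linearized model at a minimum that fits the data\<close>

lemma lin_model_residual:
  "f u \<theta>s = c \<Longrightarrow> lin_model f \<theta>s u \<theta> - c = grad (f u) \<theta>s \<bullet> (\<theta> - \<theta>s)"
  by (simp add: lin_model_def)

lemma loss_lin_model:
  assumes "\<And>i. i \<in> {1..n} \<Longrightarrow> f (x i) \<theta>s = y i"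
  shows "loss n (lin_model f \<theta>s) x y \<theta> = energy n (\<lambda>i. grad (f (x i)) \<theta>s) (\<theta> - \<theta>s) / 2"
  using assms
  by (simp add: loss_def sample_loss_def energy_def avg_def lin_model_residual
      sum_divide_distrib[symmetric])

lemma grad_batch_lin_fit:
  assumes "\<And>i. i \<in> {1..n} \<Longrightarrow> f (x i) \<theta>s = y i"
    and "\<And>j. j \<in> {1..B} \<Longrightarrow> b j \<in> {1..n}"
  shows "grad (batch_loss B (sample_loss (lin_model f \<theta>s) x y) b) \<theta>
    = (1 / real B) *\<^sub>R
      (\<Sum>j=1..B. (grad (f (x (b j))) \<theta>s \<bullet> (\<theta> - \<theta>s)) *\<^sub>R grad (f (x (b j))) \<theta>s)"
  unfolding grad_batch_lin using assms by (simp add: lin_model_residual)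

lemma batch_loss_cong: "(\<And>j. j \<in> {1..B} \<Longrightarrow> b j = b' j) \<Longrightarrow> batch_loss B l b = batch_loss B l b'"
  by (simp add: batch_loss_def fun_eq_iff)

section \<open>Growth of the expected energy in one SAM step\<close>

text \<open>The two batches of the step are integrated out separately: the descent batch yields the
  factor \<open>\<eta>\<^sup>2 * \<kappa> / real B\<close> relative to the perturbed point, the
  perturbation batch the factor \<open>1 + \<rho>\<^sup>2 * \<kappa> / real B\<close> relative to
  the iterate.\<close>

lemma (in prob_space) expectation_energy_sam_Suc:
  fixes f :: "'x \<Rightarrow> real^'p \<Rightarrow> real" and \<xi> :: "nat \<Rightarrow> nat \<Rightarrow> nat \<Rightarrow> 'a \<Rightarrow> nat"
    and x :: "nat \<Rightarrow> 'x" and y :: "nat \<Rightarrow> real" and \<theta>s \<theta>0 :: "real^'p" and n B :: nat and \<eta> \<rho> \<kappa> :: real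
  defines "g \<equiv> \<lambda>i. grad (f (x i)) \<theta>s"
  defines "\<theta> \<equiv> \<lambda>t \<omega>. sam \<eta> \<rho> B (sample_loss (lin_model f \<theta>s) x y) (\<lambda>t k j. \<xi> t k j \<omega>) \<theta>0 t"
  assumes nB: "n \<ge> 1" "B \<ge> 1" and "\<rho> \<ge> 0" and "\<kappa> \<ge> 0"
    and batches: "random_batches M n B \<xi>"
    and fit: "\<And>i. i \<in> {1..n} \<Longrightarrow> f (x i) \<theta>s = y i"
    and noise: "\<And>v. \<kappa> * energy n g v \<le> noise_energy n g v"
  shows "\<eta>\<^sup>2 * \<kappa> / real B * (1 + \<rho>\<^sup>2 * \<kappa> / real B) * expectation (\<lambda>\<omega>. energy n g (\<theta> t \<omega> - \<theta>s))
    \<le> expectation (\<lambda>\<omega>. energy n g (\<theta> (Suc t) \<omega> - \<theta>s))"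
proof -
  define l where "l = sample_loss (lin_model f \<theta>s) x y"
  \<comment> \<open>The trajectory as a function of one stream indexed by triples, so that random
    and overwritten streams can both be inserted.\<close>
  define \<Theta> where "\<Theta> b t = sam \<eta> \<rho> B l (\<lambda>t k j. b (t, k, j)) \<theta>0 t"
    for b :: "nat \<times> nat \<times> nat \<Rightarrow> nat" and t
  \<comment> \<open>The perturbed point, measured from \<open>\<theta>s\<close>.\<close>
  define w where "w b = \<Theta> b t - \<theta>s + \<rho> *\<^sub>R grad (batch_loss B l (\<lambda>j. b (t, 2, j))) (\<Theta> b t)" for b
  define X where "X = (\<lambda>(t, k, j). \<xi> t k j)"
  \<comment> \<open>\<open>K k\<close> holds the indices of batch \<open>k\<close> at time
    \<open>t\<close>, and \<open>I\<close> all indices of earlier times; these blocks are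
    disjoint.\<close>
  define K where "K k = {t} \<times> {k} \<times> {1..B}" for k :: nat
  define I where "I = {..<t} \<times> {1, 2 :: nat} \<times> {1..B}"
  let ?S = "{1..n}" and ?J = "UNIV \<times> {1, 2} \<times> {1..B}"
  have \<theta>: "\<theta> s \<omega> = \<Theta> (\<lambda>i. X i \<omega>) s" for s \<omega>
    by (simp add: \<theta>_def \<Theta>_def X_def l_def)
  have indep: "indep_vars (\<lambda>_. count_space UNIV) X ?J"
    and unif: "\<And>i. i \<in> ?J \<Longrightarrow> distr M (count_space UNIV) (X i) = measure_pmf (pmf_of_set ?S)"
    using batches by (auto simp: random_batches_def X_def)
  have S: "finite ?S" "?S \<noteq> {}" using nB by auto
  have K_eq: "K k = (\<lambda>j. (t, k, j)) ` {1..B}" for k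
    by (auto simp: K_def)
  have sum_K: "(\<Sum>i\<in>K k. h i) = (\<Sum>j=1..B. h (t, k, j))" for k and h :: "_ \<Rightarrow> real^'p"
    unfolding K_eq by (subst sum.reindex) (auto simp: inj_on_def)
  have K: "finite (K k)" "card (K k) = B" for k
    by (auto simp: K_def)
  have grad_batch: "grad (batch_loss B l (\<lambda>j. override_on a b (K k) (t, k, j))) u
      = (1 / real B) *\<^sub>R (\<Sum>i\<in>K k. (g (b i) \<bullet> (u - \<theta>s)) *\<^sub>R g (b i))"
    if "b \<in> K k \<rightarrow>\<^sub>E ?S" for a b k u
  proof -
    have b: "(t, k, j) \<in> K k" "b (t, k, j) \<in> ?S" if "j \<in> {1..B}" for j
      using that PiE_mem[OF \<open>b \<in> K k \<rightarrow>\<^sub>E ?S\<close>, of "(t, k, j)"] by (auto simp: K_def)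
    have "batch_loss B l (\<lambda>j. override_on a b (K k) (t, k, j)) = batch_loss B l (\<lambda>j. b (t, k, j))"
      by (rule batch_loss_cong) (simp add: b)
    then have "grad (batch_loss B l (\<lambda>j. override_on a b (K k) (t, k, j))) u
        = grad (batch_loss B l (\<lambda>j. b (t, k, j))) u" by simp
    also have "\<dots> = (1 / real B) *\<^sub>R (\<Sum>i\<in>K k. (g (b i) \<bullet> (u - \<theta>s)) *\<^sub>R g (b i))"
      unfolding l_def sum_K g_def by (rule grad_batch_lin_fit) (fact fit b(2))+
    finally show ?thesis .
  qed
  have \<Theta>_cong: "\<Theta> b t = \<Theta> b' t" if "\<And>i. i \<in> I \<Longrightarrow> b i = b' i" for b b'
    unfolding \<Theta>_def by (rule sam_cong) (use that in \<open>auto simp: I_def\<close>)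
  have batch_cong: "batch_loss B l (\<lambda>j. b (t, k, j)) = batch_loss B l (\<lambda>j. b' (t, k, j))"
    if "\<And>i. i \<in> K k \<Longrightarrow> b i = b' i" for b b' k
    by (rule batch_loss_cong) (use that in \<open>auto simp: K_def\<close>)
  have w_cong: "w b = w b'" if "\<And>i. i \<in> I \<union> K 2 \<Longrightarrow> b i = b' i" for b b'
    using \<Theta>_cong[of b b'] batch_cong[of 2 b b'] that by (simp add: w_def)
  have \<Theta>_Suc: "\<Theta> b (Suc t) - \<theta>s
      = \<Theta> b t - \<theta>s - \<eta> *\<^sub>R grad (batch_loss B l (\<lambda>j. b (t, 1, j))) (w b + \<theta>s)" for b
    by (simp add: \<Theta>_def w_def Let_def algebra_simps)
  have \<Theta>_Suc_cong: "\<Theta> b (Suc t) = \<Theta> b' (Suc t)"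
    if "\<And>i. i \<in> (I \<union> K 2) \<union> K 1 \<Longrightarrow> b i = b' i" for b b'
  proof -
    have "\<Theta> b (Suc t) - \<theta>s = \<Theta> b' (Suc t) - \<theta>s"
      unfolding \<Theta>_Suc
      using \<Theta>_cong[of b b'] w_cong[of b b'] batch_cong[of 1 b b'] that by simp
    then show ?thesis by simp
  qed
  have J: "finite I" "I \<union> K 2 \<subseteq> ?J" "(I \<union> K 2) \<union> K 1 \<subseteq> ?J" "I \<subseteq> ?J"
    and disj: "I \<inter> K 2 = {}" "(I \<union> K 2) \<inter> K 1 = {}"
    by (auto simp: I_def K_def)

  \<comment> \<open>History and perturbation batch are frozen in \<open>a\<close>, so the only
    randomness left is the descent batch.\<close>
  have descent: "\<eta>\<^sup>2 * \<kappa> / real B * energy n g (w a)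
      \<le> avg (K 1 \<rightarrow>\<^sub>E ?S) (\<lambda>b. energy n g (\<Theta> (override_on a b (K 1)) (Suc t) - \<theta>s))" for a
  proof -
    have "\<Theta> (override_on a b (K 1)) t = \<Theta> a t" "w (override_on a b (K 1)) = w a" for b
      using disj by (auto intro!: \<Theta>_cong w_cong simp: override_on_def)
    then have "avg (K 1 \<rightarrow>\<^sub>E ?S) (\<lambda>b. energy n g (\<Theta> (override_on a b (K 1)) (Suc t) - \<theta>s))
       = avg (K 1 \<rightarrow>\<^sub>E ?S) (\<lambda>b. energy n g ((\<Theta> a t - \<theta>s)
           + (- \<eta> / real B) *\<^sub>R (\<Sum>i\<in>K 1. (g (b i) \<bullet> w a) *\<^sub>R g (b i))))"
      unfolding \<Theta>_Suc by (intro avg_cong) (simp add: grad_batch)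
    \<comment> \<open>Only the noise term is kept; the energy of the mean step is nonnegative and is
      dropped.\<close>
    also have "\<dots> \<ge> (- \<eta> / real B)\<^sup>2 * real B * noise_energy n g (w a)"
      unfolding avg_energy_step[OF K(1) \<open>n \<ge> 1\<close>] K(2) by (simp add: energy_nonneg)
    also have "(- \<eta> / real B)\<^sup>2 * real B * noise_energy n g (w a)
        = \<eta>\<^sup>2 / real B * noise_energy n g (w a)"
      using nB by (simp add: field_simps power2_eq_square)
    also have "\<dots> \<ge> \<eta>\<^sup>2 / real B * (\<kappa> * energy n g (w a))"
      by (intro mult_left_mono noise) auto
    finally show ?thesis by (simp add: mult_ac)
  qed
  have ascent: "(1 + \<rho>\<^sup>2 * \<kappa> / real B) * energy n g (\<Theta> a t - \<theta>s)
      \<le> avg (K 2 \<rightarrow>\<^sub>E ?S) (\<lambda>b. energy n g (w (override_on a b (K 2))))" for a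
  proof -
    let ?v = "\<Theta> a t - \<theta>s"
    have "\<Theta> (override_on a b (K 2)) t = \<Theta> a t" for b
      using disj by (auto intro!: \<Theta>_cong simp: override_on_def)
    then have "avg (K 2 \<rightarrow>\<^sub>E ?S) (\<lambda>b. energy n g (w (override_on a b (K 2))))
       = avg (K 2 \<rightarrow>\<^sub>E ?S) (\<lambda>b. energy n g (?v
           + (\<rho> / real B) *\<^sub>R (\<Sum>i\<in>K 2. (g (b i) \<bullet> ?v) *\<^sub>R g (b i))))"
      unfolding w_def by (intro avg_cong) (simp add: grad_batch)
    also have "\<dots> = energy n g (?v + \<rho> *\<^sub>R gram n g ?v) + \<rho>\<^sup>2 / real B * noise_energy n g ?v"
      unfolding avg_energy_step[OF K(1) \<open>n \<ge> 1\<close>] K(2)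
      using nB by (simp add: field_simps power2_eq_square)
    \<comment> \<open>Here the mean term is kept as well: it is at least the energy before the
      perturbation, which gives the summand 1 of the factor.\<close>
    also have "\<dots> \<ge> energy n g ?v + \<rho>\<^sup>2 / real B * (\<kappa> * energy n g ?v)"
      by (intro add_mono mult_left_mono noise energy_le_energy_add_gram) (use \<open>\<rho> \<ge> 0\<close> in auto)
    finally show ?thesis by (simp add: algebra_simps)
  qed

  \<comment> \<open>After averaging, the overwritten coordinates no longer matter; this is the
    dependence condition for integrability of the partial averages.\<close>
  have cong1: "avg (K 1 \<rightarrow>\<^sub>E ?S) (\<lambda>c. energy n g (\<Theta> (override_on b c (K 1)) (Suc t) - \<theta>s))
      = avg (K 1 \<rightarrow>\<^sub>E ?S) (\<lambda>c. energy n g (\<Theta> (override_on b' c (K 1)) (Suc t) - \<theta>s))"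
    if "\<And>i. i \<in> I \<union> K 2 \<Longrightarrow> b i = b' i" for b b'
    by (intro avg_cong arg_cong[of _ _ "\<lambda>u. energy n g (u - \<theta>s)"] \<Theta>_Suc_cong)
      (use that in \<open>auto simp: override_on_def\<close>)
  have cong2: "avg (K 2 \<rightarrow>\<^sub>E ?S) (\<lambda>c. energy n g (w (override_on b c (K 2))))
      = avg (K 2 \<rightarrow>\<^sub>E ?S) (\<lambda>c. energy n g (w (override_on b' c (K 2))))"
    if "\<And>i. i \<in> I \<Longrightarrow> b i = b' i" for b b'
    by (intro avg_cong arg_cong[of _ _ "energy n g"] w_cong)
      (use that in \<open>auto simp: override_on_def\<close>)

  have IK: "finite (I \<union> K 2)" using J K by auto
  have "(1 + \<rho>\<^sup>2 * \<kappa> / real B) * expectation (\<lambda>\<omega>. energy n g (\<theta> t \<omega> - \<theta>s))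
      = expectation (\<lambda>\<omega>. (1 + \<rho>\<^sup>2 * \<kappa> / real B) * energy n g (\<Theta> (\<lambda>i. X i \<omega>) t - \<theta>s))"
    by (simp add: \<theta>)
  also have "\<dots> \<le> expectation (\<lambda>\<omega>. avg (K 2 \<rightarrow>\<^sub>E ?S)
      (\<lambda>b. energy n g (w (override_on (\<lambda>i. X i \<omega>) b (K 2)))))"
  proof (intro integral_mono ascent)
    show "integrable M (\<lambda>\<omega>. (1 + \<rho>\<^sup>2 * \<kappa> / real B) * energy n g (\<Theta> (\<lambda>i. X i \<omega>) t - \<theta>s))"
      by (rule integrable_of_coords[OF indep unif S J(1,4)])
        (assumption, rule arg_cong[of _ _ "\<lambda>u. (1 + \<rho>\<^sup>2 * \<kappa> / real B) * energy n g (u - \<theta>s)"], rule \<Theta>_cong)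
    show "integrable M (\<lambda>\<omega>. avg (K 2 \<rightarrow>\<^sub>E ?S)
      (\<lambda>b. energy n g (w (override_on (\<lambda>i. X i \<omega>) b (K 2)))))"
      by (rule integrable_of_coords[OF indep unif S J(1,4)]) (assumption, rule cong2)
  qed
  \<comment> \<open>The perturbation batch is independent of the past, so the inner average may be
    replaced by the random batch itself.\<close>
  also have "\<dots> = expectation (\<lambda>\<omega>. energy n g (w (\<lambda>i. X i \<omega>)))"
    by (rule expectation_of_coords_Un[OF indep unif S J(1) K(1) J(2) disj(1), symmetric])
      (assumption, metis w_cong)
  finally have "\<eta>\<^sup>2 * \<kappa> / real B * ((1 + \<rho>\<^sup>2 * \<kappa> / real B) * expectation (\<lambda>\<omega>. energy n g (\<theta> t \<omega> - \<theta>s)))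
      \<le> \<eta>\<^sup>2 * \<kappa> / real B * expectation (\<lambda>\<omega>. energy n g (w (\<lambda>i. X i \<omega>)))"
    using \<open>\<kappa> \<ge> 0\<close> by (intro mult_left_mono) auto
  also have "\<dots> = expectation (\<lambda>\<omega>. \<eta>\<^sup>2 * \<kappa> / real B * energy n g (w (\<lambda>i. X i \<omega>)))"
    by simp
  also have "\<dots> \<le> expectation (\<lambda>\<omega>. avg (K 1 \<rightarrow>\<^sub>E ?S)
      (\<lambda>b. energy n g (\<Theta> (override_on (\<lambda>i. X i \<omega>) b (K 1)) (Suc t) - \<theta>s)))"
  proof (intro integral_mono descent)
    show "integrable M (\<lambda>\<omega>. \<eta>\<^sup>2 * \<kappa> / real B * energy n g (w (\<lambda>i. X i \<omega>)))"
      by (rule integrable_of_coords[OF indep unif S IK J(2)])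
        (assumption, metis w_cong)
    show "integrable M (\<lambda>\<omega>. avg (K 1 \<rightarrow>\<^sub>E ?S)
      (\<lambda>b. energy n g (\<Theta> (override_on (\<lambda>i. X i \<omega>) b (K 1)) (Suc t) - \<theta>s)))"
      by (rule integrable_of_coords[OF indep unif S IK J(2)]) (assumption, rule cong1)
  qed
  \<comment> \<open>Likewise for the descent batch, which is independent of the past and of the
    perturbation batch.\<close>
  also have "\<dots> = expectation (\<lambda>\<omega>. energy n g (\<Theta> (\<lambda>i. X i \<omega>) (Suc t) - \<theta>s))"
    by (rule expectation_of_coords_Un[OF indep unif S IK K(1) J(3) disj(2), symmetric])
      (assumption, metis \<Theta>_Suc_cong)
  finally show ?thesis by (simp only: \<theta> mult.assoc)
qed

section \<open>From geometric growth and stability to the bound\<close>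

theorem theorem4p1:
  fixes f :: "real^'d \<Rightarrow> real^'p \<Rightarrow> real"
    and x :: "nat \<Rightarrow> real^'d" and y :: "nat \<Rightarrow> real"
    and \<theta>s :: "real^'p"
    and n B :: nat and \<eta> \<rho> \<gamma> :: real
    and M :: "'w measure" and \<xi> :: "nat \<Rightarrow> nat \<Rightarrow> nat \<Rightarrow> 'w \<Rightarrow> nat"
  assumes "n \<ge> 1" and "B \<ge> 1" and "\<eta> > 0" and "\<rho> \<ge> 0" and "\<gamma> > 0"
    and "\<And>i. i \<in> {1..n} \<Longrightarrow> twice_differentiable (f (x i))"
    and "\<And>\<theta>. loss n f x y \<theta>s \<le> loss n f x y \<theta>" and "loss n f x y \<theta>s = 0"
    and "random_batches M n B \<xi>"
    and "linearly_stable M \<xi> \<eta> \<rho> B n f x y \<theta>s"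
    and "\<And>\<theta>. trace (noise_cov n f x y \<theta> ** fisher n f x \<theta>)
              \<ge> 2 * \<gamma> * loss n f x y \<theta> * (norm (fisher n f x \<theta>))\<^sup>2"
  shows "(norm (loss_hessian n f x y \<theta>s))\<^sup>2
           * (1 + \<rho>\<^sup>2 * \<gamma> / real B * (norm (loss_hessian n f x y \<theta>s))\<^sup>2)
         \<le> real B / (\<eta>\<^sup>2 * \<gamma>)"
proof -
  interpret prob_space M using assms(9) by (simp add: random_batches_def)
  have "(\<Sum>i=1..n. sample_loss f x y i \<theta>s) = 0"
    using assms(1,8) by (simp add: loss_def)
  \<comment> \<open>A vanishing sum of nonnegative sample losses forces every residual to
    vanish.\<close>
  then have fit: "f (x i) \<theta>s = y i" if "i \<in> {1..n}" for i
    using that by (subst (asm) sum_nonneg_eq_0_iff) (auto simp: sample_loss_def)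
  have hessian: "loss_hessian n f x y \<theta>s = fisher n f x \<theta>s"
    using fit by (simp add: loss_hessian_def)
  define g where "g = (\<lambda>i. grad (f (x i)) \<theta>s)"
  define N where "N = (norm (fisher n f x \<theta>s))\<^sup>2"
  \<comment> \<open>\<open>\<kappa>\<close> is the guaranteed ratio of noise to energy at the
    minimum, and \<open>r\<close> the resulting growth factor of one step.\<close>
  define \<kappa> where "\<kappa> = \<gamma> * N"
  define r where "r = \<eta>\<^sup>2 * \<kappa> / real B * (1 + \<rho>\<^sup>2 * \<kappa> / real B)"
  define \<theta> where "\<theta> \<theta>0 t \<omega> = sam \<eta> \<rho> B (sample_loss (lin_model f \<theta>s) x y) (\<lambda>t k j. \<xi> t k j \<omega>) \<theta>0 t"
    for \<theta>0 t \<omega>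
  define E where "E \<theta>0 t = expectation (\<lambda>\<omega>. energy n g (\<theta> \<theta>0 t \<omega> - \<theta>s))" for \<theta>0 t
  have "\<kappa> \<ge> 0" "r \<ge> 0"
    using assms(5) by (auto simp: \<kappa>_def N_def r_def)
  have noise: "\<kappa> * energy n g v \<le> noise_energy n g v" for v
    unfolding \<kappa>_def N_def g_def by (rule noise_energy_ge) (fact assms fit)+
  have growth: "r * E \<theta>0 t \<le> E \<theta>0 (Suc t)" for \<theta>0 t
    unfolding r_def E_def \<theta>_def g_def
    by (rule expectation_energy_sam_Suc) (fact assms \<open>\<kappa> \<ge> 0\<close> fit noise[unfolded g_def])+
  have E0: "E \<theta>0 0 = energy n g (\<theta>0 - \<theta>s)" for \<theta>0
    by (simp add: E_def \<theta>_def prob_space)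
  have E_ge: "r ^ t * energy n g (\<theta>0 - \<theta>s) \<le> E \<theta>0 t" for \<theta>0 t
  proof (induction t)
    case (Suc t)
    have "r * (r ^ t * energy n g (\<theta>0 - \<theta>s)) \<le> r * E \<theta>0 t"
      using Suc \<open>r \<ge> 0\<close> by (rule mult_left_mono)
    with growth[of \<theta>0 t] show ?case by (simp add: mult_ac)
  qed (simp add: E0)
  have loss: "loss n (lin_model f \<theta>s) x y \<theta>' = energy n g (\<theta>' - \<theta>s) / 2" for \<theta>'
    unfolding g_def by (rule loss_lin_model) (fact fit)
  \<comment> \<open>The factor 1/2 between loss and energy cancels, so the same \<open>C\<close>
    bounds the energy.\<close>
  obtain C U where CU: "open U" "\<theta>s \<in> U"
    and stable: "\<And>\<theta>0 t. \<theta>0 \<in> U \<Longrightarrow> E \<theta>0 t \<le> C * E \<theta>0 0"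
    using assms(10) unfolding linearly_stable_def Let_def
    by (auto simp: loss E_def \<theta>_def)
  \<comment> \<open>For \<open>N = 0\<close> the factor \<open>r\<close> is 0. Otherwise some
    gradient \<open>g i\<close> is nonzero, and a start displaced along it has positive energy, so
    the growth bound has content.\<close>
  have "r \<le> 1"
  proof (cases "N = 0")
    case True
    then show ?thesis by (simp add: r_def \<kappa>_def)
  next
    case False
    then have "fisher n f x \<theta>s \<noteq> 0" by (simp add: N_def)
    then obtain i where i: "i \<in> {1..n}" "g i \<noteq> 0"
      unfolding g_def by (rule fisher_nonzeroE)
    obtain e where e: "e > 0" "ball \<theta>s e \<subseteq> U"
      using CU openE by blast
    \<comment> \<open>This scaling gives the displacement length \<open>e / 2\<close>, inside the
      ball.\<close>
    define s where "s = e / (2 * norm (g i))"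
    let ?\<theta>0 = "\<theta>s + s *\<^sub>R g i"
    have s: "s > 0" using e i by (simp add: s_def)
    have "?\<theta>0 \<in> U"
      using e i by (intro subsetD[OF e(2)]) (simp add: dist_norm s_def)
    have "0 < (g i \<bullet> (?\<theta>0 - \<theta>s))\<^sup>2"
      using s i by simp
    then have "0 < energy n g (?\<theta>0 - \<theta>s)"
      unfolding energy_def avg_def using i assms(1)
      by (intro divide_pos_pos sum_pos2[of _ i]) auto
    moreover have "r ^ t * energy n g (?\<theta>0 - \<theta>s) \<le> C * energy n g (?\<theta>0 - \<theta>s)" for t
      using E_ge[of t ?\<theta>0] stable[OF \<open>?\<theta>0 \<in> U\<close>, of t] by (simp add: E0)
    ultimately have "r ^ t \<le> C" for t by simp
    \<comment> \<open>The powers of a number above 1 would exceed \<open>C\<close>.\<close>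
    then show ?thesis
      using real_arch_pow[of r C] by (meson not_le)
  qed
  \<comment> \<open>Dividing \<open>r \<le> 1\<close> by the positive number
    \<open>\<eta>\<^sup>2 * \<gamma> / real B\<close> is the claim.\<close>
  then show ?thesis
    using assms(2,3,5) unfolding hessian N_def[symmetric] r_def \<kappa>_def
    by (simp add: field_simps)
qed

end
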